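(* Let $(X,d)$ be a complete metric space, let $S\subset X$ be a nonempty closed set, let $Y$ be a (real, Hausdorff) locally convex topological vector space, let $D\subset Y$ be a closed convex cone, and let $H\subset D\setminus(-D)$ be a nonempty, $\sigma(Y,D^+)$-countably compact, $D$-convex set. Suppose that $f:X\to Y$ is submonotone with respect to $D$, that $\epsilon>0$, and that $x_0\in S$ is an $\epsilon$-efficient solution in the sense of Németh with respect to $H$ of the problem $\mathrm{Min}\{f(x):x\in S\}$, i.e. $(f(S)-f(x_0))\cap(-\epsilon H-D)=\emptyset$. Then, for any $\gamma>0$, there exists $\hat{x}\in S$ such that (a) $f(x_0)\in f(\hat{x})+\gamma d(x_0,\hat{x})H+D$; (b) $d(x_0,\hat{x})<\epsilon/\gamma$; (c) for all $x\in S\setminus\{\hat{x}\}$, $f(\hat{x})\notin f(x)+\gamma d(\hat{x},x)H+D$.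
   Context: A convex cone is a nonempty set $D\subset Y$ with $D+D\subset D$ and $\alpha D\subset D$ for all $\alpha\ge0$; it defines the quasi-order $y_1\le_D y_2\iff y_1-y_2\in-D$. Sums and scalar multiples of sets are elementwise. A set $H\subset Y$ is $D$-convex if $H+D$ is convex. $Y^*$ is the topological dual of $Y$ and $D^+=\{\xi\in Y^*:\xi(d)\ge0\ \forall d\in D\}$. $\sigma(Y,D^+)$ is the (not necessarily Hausdorff) locally convex topology on $Y$ generated by the seminorms $y\mapsto|\xi(y)|$, $\xi\in D^+$. $H$ is $\sigma(Y,D^+)$-countably compact if every sequence in $H$ has a cluster point in $H$ with respect to $\sigma(Y,D^+)$. The map $f:X\to Y$ is (sequentially) submonotone with respect to $D$ if for every $x\in X$ and every sequence $(x_n)$ in $X$ with $x_n\to x$ and $f(x_m)\le_D f(x_n)$ for all $m>n$, one has $f(x)\le_D f(x_n)$ for all $n$. *)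

theory Defs
  imports "HOL-Analysis.Analysis" "HOL-Library.Set_Algebras"
begin

class topological_real_vector = real_vector + topological_ab_group_add +
  assumes tendsto_scaleR_nhds:
    "((\<lambda>p. fst p *\<^sub>R snd p) \<longlongrightarrow> c *\<^sub>R x) (nhds c \<times>\<^sub>F nhds x)"

text \<open>
  Real, Hausdorff, locally convex topological vector spaces. The sort constraint of \<^const>\<open>convex\<close>
  rules it out in a class specification, so its definition is unfolded here; see
  \<open>locally_convex\<close> below.
\<close>

class locally_convex_space = topological_real_vector + t2_space +
  assumes locally_convex_nhds:
    "open U \<Longrightarrow> 0 \<in> U \<Longrightarrow> \<exists>V. open V \<and>
       (\<forall>x\<in>V. \<forall>y\<in>V. \<forall>u\<ge>0. \<forall>v\<ge>0. u + v = 1 \<longrightarrow> u *\<^sub>R x + v *\<^sub>R y \<in> V) \<and> 0 \<in> V \<and> V \<subseteq> U"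

lemma locally_convex:
  fixes U :: "'b::locally_convex_space set"
  assumes "open U" and "0 \<in> U"
  shows "\<exists>V. open V \<and> convex V \<and> 0 \<in> V \<and> V \<subseteq> U"
  using locally_convex_nhds[OF assms] unfolding convex_def .

instance real_normed_vector \<subseteq> locally_convex_space
proof
  fix c :: real and x :: 'a
  show "((\<lambda>p. fst p *\<^sub>R snd p) \<longlongrightarrow> c *\<^sub>R x) (nhds c \<times>\<^sub>F nhds x)"
    by (rule tendsto_scaleR[OF filterlim_fst filterlim_snd])
next
  fix U :: "'a set"
  assume "open U" "0 \<in> U"
  then obtain e where "0 < e" "ball 0 e \<subseteq> U"
    by (auto simp: open_contains_ball)
  then have "open (ball (0::'a) e) \<and> convex (ball (0::'a) e) \<and> 0 \<in> ball (0::'a) e \<and> ball 0 e \<subseteq> U"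
    by simp
  then show "\<exists>V. open V \<and>
       (\<forall>x\<in>V. \<forall>y\<in>V. \<forall>u\<ge>0. \<forall>v\<ge>0. u + v = 1 \<longrightarrow> u *\<^sub>R x + v *\<^sub>R y \<in> V) \<and> 0 \<in> V \<and> V \<subseteq> U"
    unfolding convex_def by (rule exI)
qed

text \<open>
  Elementwise operations on sets: \<open>A + B\<close> and \<open>a +o B\<close> come from \<^theory>\<open>HOL-Library.Set_Algebras\<close>,
  \<open>cA\<close> is written \<open>(*\<^sub>R) c ` A\<close>, and the negative of \<open>A\<close> is \<open>uminus ` A\<close>
  (on sets, \<open>- A\<close> denotes the complement). The closed convex cones below are sets satisfying
  the library predicate \<^const>\<open>convex_cone\<close>.
\<close>

definition le_cone :: "'b::real_vector set \<Rightarrow> 'b \<Rightarrow> 'b \<Rightarrow> bool" where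
  "le_cone D y1 y2 \<longleftrightarrow> y1 - y2 \<in> uminus ` D"

definition cone_convex :: "'b::real_vector set \<Rightarrow> 'b set \<Rightarrow> bool" where
  "cone_convex D H \<longleftrightarrow> convex (H + D)"

definition topological_dual :: "('b::topological_real_vector \<Rightarrow> real) set" where
  "topological_dual = {\<xi>. linear \<xi> \<and> continuous_on UNIV \<xi>}"

definition dual_cone :: "'b::topological_real_vector set \<Rightarrow> ('b \<Rightarrow> real) set" where
  "dual_cone D = {\<xi> \<in> topological_dual. \<forall>d\<in>D. 0 \<le> \<xi> d}"

text \<open>
  The open balls of the seminorms, around all centres, form a subbase. For a nonempty family
  \<open>P\<close> the carrier is the whole space.
\<close>

definition seminorm_topology :: "('b::real_vector \<Rightarrow> real) set \<Rightarrow> 'b topology" where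
  "seminorm_topology P = topology_generated_by {{y. p (y - a) < r} | p a r. p \<in> P \<and> 0 < r}"

definition sigma_topology :: "'b::topological_real_vector set \<Rightarrow> 'b topology" where
  "sigma_topology D = seminorm_topology ((\<lambda>\<xi> y. \<bar>\<xi> y\<bar>) ` dual_cone D)"

lemma topspace_sigma_topology [simp]: "topspace (sigma_topology D) = UNIV"
proof -
  have "(\<lambda>y. 0::real) \<in> dual_cone D"
    by (simp add: dual_cone_def topological_dual_def linear_iff)
  then have "(\<lambda>y. \<bar>0::real\<bar>) \<in> (\<lambda>\<xi> y. \<bar>\<xi> y\<bar>) ` dual_cone D"
    by (rule rev_image_eqI) simp
  then have "UNIV \<in> {{y. p (y - a) < r} | p a r. p \<in> (\<lambda>\<xi> y. \<bar>\<xi> y\<bar>) ` dual_cone D \<and> 0 < r}"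
    by (intro CollectI exI[of _ "\<lambda>y. \<bar>0::real\<bar>"] exI[of _ 0] exI[of _ "1::real"]) simp
  then show ?thesis
    unfolding sigma_topology_def seminorm_topology_def topology_generated_by_topspace
    by (meson UNIV_I Union_upper subset_antisym subset_UNIV)
qed

definition cluster_point_in :: "'b topology \<Rightarrow> (nat \<Rightarrow> 'b) \<Rightarrow> 'b \<Rightarrow> bool" where
  "cluster_point_in T s l \<longleftrightarrow> l \<in> topspace T \<and>
     (\<forall>U. openin T U \<and> l \<in> U \<longrightarrow> (\<exists>\<^sub>F n in sequentially. s n \<in> U))"

definition countably_compact_in :: "'b topology \<Rightarrow> 'b set \<Rightarrow> bool" where
  "countably_compact_in T H \<longleftrightarrow>
     (\<forall>s. range s \<subseteq> H \<longrightarrow> (\<exists>h\<in>H. cluster_point_in T s h))"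

definition submonotone :: "'b::real_vector set \<Rightarrow> ('a::topological_space \<Rightarrow> 'b) \<Rightarrow> bool" where
  "submonotone D f \<longleftrightarrow>
     (\<forall>x s. s \<longlonglongrightarrow> x \<and> (\<forall>n m. n < m \<longrightarrow> le_cone D (f (s m)) (f (s n)))
        \<longrightarrow> (\<forall>n. le_cone D (f x) (f (s n))))"

definition nemeth_efficient ::
  "('a \<Rightarrow> 'b::real_vector) \<Rightarrow> 'a set \<Rightarrow> 'b set \<Rightarrow> 'b set \<Rightarrow> real \<Rightarrow> 'a \<Rightarrow> bool" where
  "nemeth_efficient f S D H \<epsilon> x0 \<longleftrightarrow> x0 \<in> S \<and>
     (\<lambda>y. y - f x0) ` f ` S \<inter> ((*\<^sub>R) (- \<epsilon>) ` H + uminus ` D) = {}"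

end

theory Submission
  imports Defs
begin

text \<open>
  Write \<open>x \<rightarrow> z\<close> when \<open>f x - f z \<in> \<gamma> d(x,z) H + D\<close>. The theorem asks for a point reachable from
  \<open>x0\<close> from which only the point itself can be reached, and such a point is found by greedy descent:
  from each point jump to a successor at least half as far away as any other successor.

  Three facts make this work. Convexity of \<open>H + D\<close> gives \<open>sH + tH \<subseteq> (s+t)H + D\<close>, so along a chain
  the step lengths add up; hence \<open>\<rightarrow>\<close> is transitive and the total length of any chain starting in
  \<open>x0\<close> is below \<open>\<epsilon>/\<gamma>\<close>, since a chain of length at least \<open>\<epsilon>/\<gamma>\<close> would end in a point that contradicts
  efficiency of \<open>x0\<close>. A greedy chain is therefore a Cauchy sequence, with jumps tending to \<open>0\<close>. Lastly,
  its limit is still reachable from every member of the chain: submonotonicity bounds the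
  value of \<open>f\<close> at the limit, and what remains is to let \<open>t\<^sub>m\<close> tend to \<open>t\<close> in \<open>y - t\<^sub>m h\<^sub>m \<in> D\<close>, where the
  \<open>h\<^sub>m \<in> H\<close> need not converge. There a \<open>\<sigma>(Y,D\<^sup>+)\<close>-cluster point \<open>h\<close> of the \<open>h\<^sub>m\<close> satisfies
  \<open>\<xi> (y - t h) \<ge> 0\<close> for all \<open>\<xi> \<in> D\<^sup>+\<close>, and by the bipolar theorem this means \<open>y - t h \<in> D\<close>.

  The bipolar theorem rests on the separation of a point from a closed convex cone in
  a locally convex space, which is derived here from Zorn's lemma applied to convex cones.
\<close>

section \<open>Separation of a point from a closed convex cone\<close>

text \<open>
  Enlarging a maximal cone that misses \<open>-e\<close> by the ray through an outside point puts \<open>-e\<close> into it.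
  If \<open>w\<close> and \<open>- w\<close> were both outside, combining the two resulting representations of \<open>-e\<close> would express a negative multiple of \<open>e\<close> by elements of the cone, so a maximal cone is a half-space.
\<close>

lemma convex_cone_extends_to_half_space:
  fixes K :: "'b::real_vector set"
  assumes K: "convex_cone K" and e: "- e \<notin> K"
  obtains M where "convex_cone M" "K \<subseteq> M" "- e \<notin> M" "\<And>w. w \<in> M \<or> - w \<in> M"
proof -
  define A where "A = {M. convex_cone M \<and> K \<subseteq> M \<and> - e \<notin> M}"
  have "\<exists>M\<in>A. \<forall>X\<in>A. M \<subseteq> X \<longrightarrow> X = M"
  proof (rule subset_Zorn_nonempty)
    show "A \<noteq> {}" using K e by (auto simp: A_def)
    fix C assume ne: "C \<noteq> {}" and ch: "subset.chain A C"
    have sub: "C \<subseteq> A" using ch by (simp add: subset_chain_def)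
    have "x + y \<in> \<Union>C" if "x \<in> \<Union>C" "y \<in> \<Union>C" for x y
    proof -
      from that obtain P Q where PQ: "P \<in> C" "Q \<in> C" "x \<in> P" "y \<in> Q" by blast
      have "P \<subseteq> Q \<or> Q \<subseteq> P" using ch PQ by (auto simp: subset_chain_def)
      then obtain R where R: "R \<in> C" "x \<in> R" "y \<in> R" using PQ by blast
      then have "convex_cone R" using sub by (auto simp: A_def)
      then show ?thesis using R convex_cone_add by blast
    qed
    moreover have "c *\<^sub>R x \<in> \<Union>C" if "x \<in> \<Union>C" "c \<ge> 0" for x c
    proof -
      from that obtain P where P: "P \<in> C" "x \<in> P" by blast
      then have "convex_cone P" using sub by (auto simp: A_def)
      then show ?thesis using P that(2) convex_cone_scaleR by blast
    qed
    moreover have "K \<subseteq> \<Union>C" using ne sub by (auto simp: A_def)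
    moreover have "0 \<in> K" using K convex_cone_contains_0 by blast
    ultimately have "convex_cone (\<Union>C)"
      unfolding convex_cone_iff by (meson subsetD)
    then show "\<Union>C \<in> A" using \<open>K \<subseteq> \<Union>C\<close> sub by (auto simp: A_def)
  qed
  then obtain M where MA: "M \<in> A" and maxA: "\<forall>X\<in>A. M \<subseteq> X \<longrightarrow> X = M" by (rule bexE)
  have M: "convex_cone M" "K \<subseteq> M" "- e \<notin> M" using MA by (simp_all add: A_def)
  have max: "X = M" if "convex_cone X" "K \<subseteq> X" "- e \<notin> X" "M \<subseteq> X" for X
    using maxA that by (simp add: A_def)
  have ray: "\<exists>m\<in>M. \<exists>a>0. - e = m + a *\<^sub>R w" if w: "w \<notin> M" for w
  proof -
    define X where "X = {m + a *\<^sub>R w | m a. m \<in> M \<and> a \<ge> 0}"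
    have X0: "m + a *\<^sub>R w \<in> X" if "m \<in> M" "a \<ge> 0" for m a using that by (auto simp: X_def)
    have 0: "0 \<in> M" using M(1) convex_cone_contains_0 by blast
    have MX: "M \<subseteq> X" using X0[of _ 0] by auto
    have "convex_cone X"
      unfolding convex_cone_iff
    proof (intro conjI ballI allI impI)
      show "0 \<in> X" using 0 MX by blast
    next
      fix x y assume "x \<in> X" "y \<in> X"
      then obtain m a n b where "x = m + a *\<^sub>R w" "m \<in> M" "a \<ge> 0" "y = n + b *\<^sub>R w" "n \<in> M" "b \<ge> 0"
        by (auto simp: X_def)
      then have "x + y = (m + n) + (a + b) *\<^sub>R w" "m + n \<in> M" "a + b \<ge> 0"
        using convex_cone_add[OF M(1)] by (auto simp: algebra_simps)
      then show "x + y \<in> X" using X0 by metis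
    next
      fix x and c :: real assume "x \<in> X" "0 \<le> c"
      then obtain m a where "x = m + a *\<^sub>R w" "m \<in> M" "a \<ge> 0" by (auto simp: X_def)
      then have "c *\<^sub>R x = c *\<^sub>R m + (c * a) *\<^sub>R w" "c *\<^sub>R m \<in> M" "c * a \<ge> 0"
        using convex_cone_scaleR[OF M(1)] \<open>0 \<le> c\<close> by (auto simp: algebra_simps)
      then show "c *\<^sub>R x \<in> X" using X0 by metis
    qed
    moreover have "w \<in> X" using X0[OF 0, of 1] by simp
    ultimately have "- e \<in> X" using max[of X] MX M(2) w by blast
    then obtain m a where ma: "- e = m + a *\<^sub>R w" "m \<in> M" "a \<ge> 0" by (auto simp: X_def)
    have "a \<noteq> 0"
    proof
      assume "a = 0"
      then have "- e = m" using ma(1) by simp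
      then show False using M(3) ma(2) by simp
    qed
    then show ?thesis using ma by (intro bexI[of _ m] exI[of _ a]) simp_all
  qed
  have "w \<in> M \<or> - w \<in> M" for w
  proof (rule ccontr)
    assume "\<not> (w \<in> M \<or> - w \<in> M)"
    then obtain m a n b where 1: "m \<in> M" "a > 0" "- e = m + a *\<^sub>R w"
      and 2: "n \<in> M" "b > 0" "- e = n + b *\<^sub>R (- w)"
      using ray[of w] ray[of "- w"] by blast
    have m: "m = - e - a *\<^sub>R w" and n: "n = - e + b *\<^sub>R w"
      using 1(3) 2(3) by (simp_all add: algebra_simps)
    \<comment> \<open>The combination that eliminates \<open>w\<close> from the two representations of \<open>- e\<close>.\<close>
    have "b *\<^sub>R m + a *\<^sub>R n = (a + b) *\<^sub>R (- e)"
      unfolding m n by (simp add: algebra_simps)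
    moreover have "b *\<^sub>R m + a *\<^sub>R n \<in> M"
      using 1 2 by (intro convex_cone_add convex_cone_scaleR M(1)) auto
    ultimately have "(a + b) *\<^sub>R (- e) \<in> M" by (simp only:)
    then have "(1 / (a + b)) *\<^sub>R ((a + b) *\<^sub>R (- e)) \<in> M"
      by (rule convex_cone_scaleR[OF M(1), rotated]) (use 1(2) 2(2) in simp)
    then show False using M(3) 1(2) 2(2) by simp
  qed
  then show thesis using that M by blast
qed

text \<open>
  Krein's extension theorem for a cone with order unit \<open>e\<close>. In a half-space containing the cone,
  \<open>\<xi> z\<close> is the threshold at which \<open>t e - z\<close> enters; it is sublinear because the half-space is
  a convex cone, and odd because the half-space and its negative cover everything.
\<close>

lemma positive_functional_of_order_unit:
  fixes K :: "'b::real_vector set"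
  assumes K: "convex_cone K" and e: "- e \<notin> K" and unit: "\<And>z. \<exists>t. z + t *\<^sub>R e \<in> K"
  obtains \<xi> :: "'b \<Rightarrow> real" where "linear \<xi>" "\<And>k. k \<in> K \<Longrightarrow> 0 \<le> \<xi> k" "\<xi> e = 1"
proof -
  obtain M where M: "convex_cone M" "K \<subseteq> M" "- e \<notin> M" and half: "\<And>w. w \<in> M \<or> - w \<in> M"
    using convex_cone_extends_to_half_space[OF K e] by blast
  note add = convex_cone_add[OF M(1)] and scale = convex_cone_scaleR[OF M(1)]
  have 0: "0 \<in> M" using M(1) convex_cone_contains_0 by blast
  have neg: "t \<ge> 0" if "t *\<^sub>R e \<in> M" for t
  proof (rule ccontr)
    assume t: "\<not> t \<ge> 0"
    have "(- 1 / t) *\<^sub>R (t *\<^sub>R e) \<in> M" using t by (intro scale that) (simp add: field_simps)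
    then show False using t M(3) by simp
  qed
  define T where "T z = {t. t *\<^sub>R e - z \<in> M}" for z
  define \<xi> where "\<xi> z = Inf (T z)" for z
  have ne: "T z \<noteq> {}" for z
    using unit[of "- z"] M(2) by (auto simp: T_def algebra_simps)
  have T_add: "s + t \<in> T (z + w)" if "s \<in> T z" "t \<in> T w" for s t z w
  proof -
    have "(s *\<^sub>R e - z) + (t *\<^sub>R e - w) \<in> M" using that add by (simp add: T_def)
    then show ?thesis by (simp add: T_def algebra_simps)
  qed
  have T_opp: "0 \<le> s + t" if "s \<in> T z" "t \<in> T (- z)" for s t z
    using T_add[OF that] neg by (simp add: T_def)
  have bdd: "bdd_below (T z)" for z
  proof -
    obtain t where "t \<in> T (- z)" using ne by blast
    then show ?thesis using T_opp[of _ z t] by (intro bdd_belowI[of _ "- t"]) force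
  qed
  have le: "\<xi> z \<le> t" if "t \<in> T z" for t z
    unfolding \<xi>_def using that bdd by (rule cInf_lower)
  have ge: "c \<le> \<xi> z" if "\<And>t. t \<in> T z \<Longrightarrow> c \<le> t" for c z
    unfolding \<xi>_def using ne that by (rule cInf_greatest)
  have sub: "\<xi> (z + w) \<le> \<xi> z + \<xi> w" for z w
  proof -
    have "\<xi> (z + w) - t \<le> \<xi> z" if t: "t \<in> T w" for t
      using le[OF T_add[OF _ t]] by (intro ge) (simp add: diff_le_eq)
    then have "\<xi> (z + w) - \<xi> z \<le> t" if t: "t \<in> T w" for t using that by force
    then have "\<xi> (z + w) - \<xi> z \<le> \<xi> w" by (rule ge)
    then show ?thesis by simp
  qed
  have odd: "\<xi> (- z) = - \<xi> z" for z
  proof (rule antisym)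
    show "\<xi> (- z) \<le> - \<xi> z"
    proof (rule ccontr)
      assume "\<not> \<xi> (- z) \<le> - \<xi> z"
      then obtain r where r: "- \<xi> z < r" "r < \<xi> (- z)" using dense not_le by blast
      then have "r \<notin> T (- z)" "- r \<notin> T z" using le by force+
      then show False using half[of "r *\<^sub>R e + z"] by (simp add: T_def)
    qed
    have "- \<xi> (- z) \<le> s" if s: "s \<in> T z" for s
      using ge[of "- z" "- s"] T_opp[OF s] by force
    then have "- \<xi> (- z) \<le> \<xi> z" by (rule ge)
    then show "- \<xi> z \<le> \<xi> (- z)" by simp
  qed
  have plus: "\<xi> (z + w) = \<xi> z + \<xi> w" for z w
  proof (rule antisym[OF sub])
    have "\<xi> z \<le> \<xi> (z + w) + \<xi> (- w)" using sub[of "z + w" "- w"] by simp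
    then show "\<xi> z + \<xi> w \<le> \<xi> (z + w)" by (simp add: odd)
  qed
  have pos: "0 \<le> \<xi> z" if "z \<in> M" for z
    using le[of 0 "- z"] that odd[of z] by (simp add: T_def)
  have scale_le: "\<xi> (c *\<^sub>R z) \<le> c * \<xi> z" if c: "c > 0" for c z
  proof -
    have "\<xi> (c *\<^sub>R z) / c \<le> t" if "t \<in> T z" for t
    proof -
      have "c *\<^sub>R (t *\<^sub>R e - z) \<in> M" using that c by (intro scale) (auto simp: T_def)
      then have "c * t \<in> T (c *\<^sub>R z)" by (simp add: T_def algebra_simps)
      then show ?thesis using le c by (simp add: field_simps)
    qed
    then have "\<xi> (c *\<^sub>R z) / c \<le> \<xi> z" by (rule ge)
    then show ?thesis using c by (simp add: field_simps)
  qed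
  have scale_pos: "\<xi> (c *\<^sub>R z) = c * \<xi> z" if c: "c > 0" for c z
    using scale_le[OF c, of z] scale_le[OF c, of "- z"] odd[of "c *\<^sub>R z"] odd[of z] by auto
  have "\<xi> (c *\<^sub>R z) = c * \<xi> z" for c z
  proof -
    consider "c > 0" | "c = 0" | "c < 0" by linarith
    then show ?thesis
    proof cases
      case 2 then show ?thesis using plus[of 0 0] by simp
    next
      case 3 then show ?thesis using scale_pos[of "- c" z] odd[of "c *\<^sub>R z"] by simp
    qed (rule scale_pos)
  qed
  then have "linear \<xi>" using plus by (intro linearI) auto
  moreover have "\<xi> e = 1"
  proof (rule antisym)
    show "\<xi> e \<le> 1" using 0 by (intro le) (simp add: T_def)
    show "1 \<le> \<xi> e"
    proof (rule ge)
      fix t assume "t \<in> T e"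
      then have "(t - 1) *\<^sub>R e \<in> M" by (simp add: T_def algebra_simps)
      then show "1 \<le> t" using neg by force
    qed
  qed
  ultimately show thesis using that pos M(2) by blast
qed

lemma continuous_scaleR_right:
  fixes c :: real
  shows "continuous_on UNIV (\<lambda>x::'b::topological_real_vector. c *\<^sub>R x)"
proof -
  have "((\<lambda>z. c *\<^sub>R z) \<longlongrightarrow> c *\<^sub>R x) (nhds x)" for x :: 'b
  proof -
    have "filterlim (\<lambda>z. (c, z)) (nhds c \<times>\<^sub>F nhds x) (nhds x)"
      by (intro filterlim_Pair tendsto_const filterlim_ident)
    from filterlim_compose[OF tendsto_scaleR_nhds this] show ?thesis by simp
  qed
  then show ?thesis
    by (auto simp: continuous_on_def intro: tendsto_mono[OF at_within_le_nhds])
qed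

lemma neighbourhood_of_0_absorbs:
  fixes V :: "'b::topological_real_vector set"
  assumes "open V" "0 \<in> V"
  obtains s :: real where "s > 0" "(1 / s) *\<^sub>R z \<in> V"
proof -
  have "filterlim (\<lambda>n. (1 / real (Suc n), z)) (nhds 0 \<times>\<^sub>F nhds z) sequentially"
    using LIMSEQ_inverse_real_of_nat
    by (intro filterlim_Pair tendsto_const) (simp add: inverse_eq_divide)
  from filterlim_compose[OF tendsto_scaleR_nhds this]
  have "(\<lambda>n. (1 / real (Suc n)) *\<^sub>R z) \<longlonglongrightarrow> 0" by simp
  then have "\<forall>\<^sub>F n in sequentially. (1 / real (Suc n)) *\<^sub>R z \<in> V"
    using assms by (rule topological_tendstoD)
  then obtain n where "(1 / real (Suc n)) *\<^sub>R z \<in> V"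
    by (meson eventually_happens sequentially_bot)
  then show thesis using that[of "real (Suc n)"] by simp
qed

lemma linear_continuous_of_bounded_on_neighbourhood:
  fixes \<xi> :: "'b::topological_real_vector \<Rightarrow> real"
  assumes lin: "linear \<xi>" and V: "open V" "0 \<in> V" and bd: "\<And>v. v \<in> V \<Longrightarrow> \<bar>\<xi> v\<bar> \<le> 1"
  shows "continuous_on UNIV \<xi>"
proof -
  have "(\<xi> \<longlongrightarrow> \<xi> x) (at x)" for x
  proof (rule tendstoI)
    fix e :: real assume e: "e > 0"
    let ?g = "\<lambda>z. (2 / e) *\<^sub>R (z - x)"
    have "continuous_on UNIV ?g"
      by (rule continuous_on_compose2[OF continuous_scaleR_right]) (auto intro!: continuous_intros)
    then have "open (?g -` V)" using V(1) by (rule open_vimage[rotated])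
    moreover have "x \<in> ?g -` V" using V(2) by simp
    moreover have "dist (\<xi> z) (\<xi> x) < e" if "z \<in> ?g -` V" for z
    proof -
      have "\<bar>\<xi> (?g z)\<bar> \<le> 1" using that bd by simp
      moreover have "\<xi> (?g z) = (2 / e) * (\<xi> z - \<xi> x)"
        using linear_cmul[OF lin, of "2 / e" "z - x"] linear_diff[OF lin, of z x] by simp
      ultimately have "(2 / e) * \<bar>\<xi> z - \<xi> x\<bar> \<le> 1" using e by (simp only: abs_mult) simp
      then have "\<bar>\<xi> z - \<xi> x\<bar> \<le> e / 2" using e by (simp add: field_simps)
      then show ?thesis using e by (simp add: dist_real_def)
    qed
    ultimately show "\<forall>\<^sub>F z in at x. dist (\<xi> z) (\<xi> x) < e"
      unfolding eventually_at_topological by blast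
  qed
  then show ?thesis by (simp add: continuous_on_def)
qed

text \<open>
  If a convex neighbourhood \<open>y + V\<close> of \<open>y\<close> misses \<open>D\<close>, then the cone generated by \<open>D\<close> and \<open>-(y + V)\<close>
  misses \<open>y\<close> and has \<open>- y\<close> as an order unit. The resulting functional is bounded above on \<open>V\<close>, which
  makes it continuous.
\<close>

lemma separate_point_from_closed_convex_cone:
  fixes D :: "'b::locally_convex_space set"
  assumes D: "closed D" "convex_cone D" and y: "y \<notin> D"
  obtains \<xi> where "\<xi> \<in> dual_cone D" "\<xi> y < 0"
proof -
  have 0: "0 \<in> D" using D(2) convex_cone_contains_0 by blast
  have "open ((\<lambda>v. y + v) -` (- D))"
    using D(1) by (intro open_vimage) (auto intro!: continuous_intros)
  moreover have "0 \<in> (\<lambda>v. y + v) -` (- D)" using y by simp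
  ultimately obtain V where V: "open V" "convex V" "0 \<in> V" and VD: "\<And>v. v \<in> V \<Longrightarrow> y + v \<notin> D"
    using locally_convex[of "(\<lambda>v. y + v) -` (- D)"] by blast
  define K where "K = {d - s *\<^sub>R (y + v) | d s v. d \<in> D \<and> s \<ge> 0 \<and> v \<in> V}"
  have KI: "d - s *\<^sub>R (y + v) \<in> K" if "d \<in> D" "s \<ge> 0" "v \<in> V" for d s v
    using that by (auto simp: K_def)
  have cone: "convex_cone K"
    unfolding convex_cone_iff
  proof (intro conjI ballI allI impI)
    show "0 \<in> K" using KI[OF 0, of 0 0] V(3) by simp
  next
    fix p q assume "p \<in> K" "q \<in> K"
    then obtain d s v d' s' v' where
      p: "p = d - s *\<^sub>R (y + v)" "d \<in> D" "s \<ge> 0" "v \<in> V" and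
      q: "q = d' - s' *\<^sub>R (y + v')" "d' \<in> D" "s' \<ge> 0" "v' \<in> V"
      by (auto simp: K_def)
    have dd: "d + d' \<in> D" using p q convex_cone_add[OF D(2)] by blast
    show "p + q \<in> K"
    proof (cases "s + s' = 0")
      case True
      then have "s = 0" "s' = 0" using p q by auto
      then have "p + q = (d + d') - 0 *\<^sub>R (y + v)" unfolding p(1) q(1) by simp
      then show ?thesis using KI[OF dd order_refl p(4)] by metis
    next
      case False
      then have ss: "s + s' > 0" using p q by auto
      let ?w = "(s / (s + s')) *\<^sub>R v + (s' / (s + s')) *\<^sub>R v'"
      have "?w \<in> V"
        using V(2) p q ss by (intro convexD) (auto simp: add_divide_distrib[symmetric])
      moreover have "(s + s') *\<^sub>R ?w = s *\<^sub>R v + s' *\<^sub>R v'"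
        using ss by (simp add: scaleR_right_distrib)
      then have "p + q = (d + d') - (s + s') *\<^sub>R (y + ?w)"
        unfolding p(1) q(1) scaleR_right_distrib[of "s + s'" y] by (simp add: algebra_simps)
      ultimately show ?thesis using KI[OF dd, of "s + s'" ?w] ss by simp
    qed
  next
    fix p and c :: real assume "p \<in> K" "0 \<le> c"
    then obtain d s v where p: "p = d - s *\<^sub>R (y + v)" "d \<in> D" "s \<ge> 0" "v \<in> V"
      by (auto simp: K_def)
    have "c *\<^sub>R p = c *\<^sub>R d - (c * s) *\<^sub>R (y + v)"
      unfolding p(1) by (simp add: algebra_simps)
    then show "c *\<^sub>R p \<in> K"
      using KI[of "c *\<^sub>R d" "c * s" v] p \<open>0 \<le> c\<close> convex_cone_scaleR[OF D(2)] by simp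
  qed
  have yK: "- (- y) \<notin> K"
  proof
    assume "- (- y) \<in> K"
    then obtain d s v where p: "y = d - s *\<^sub>R (y + v)" "d \<in> D" "s \<ge> 0" "v \<in> V"
      by (auto simp: K_def)
    \<comment> \<open>Then \<open>d / (1 + s)\<close> is a point of \<open>y + V\<close>.\<close>
    have d: "d = (1 + s) *\<^sub>R y + s *\<^sub>R v" using p(1) by (simp add: algebra_simps)
    have "(1 / (1 + s)) *\<^sub>R d = y + (s / (1 + s)) *\<^sub>R v"
      unfolding d using p(3) by (simp add: scaleR_right_distrib)
    moreover have "(1 / (1 + s)) *\<^sub>R 0 + (s / (1 + s)) *\<^sub>R v \<in> V"
      using V p by (intro convexD) (auto simp: add_divide_distrib[symmetric])
    moreover have "(1 / (1 + s)) *\<^sub>R d \<in> D" using p convex_cone_scaleR[OF D(2)] by simp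
    ultimately show False using VD by (metis add_0 scaleR_zero_right)
  qed
  have unit: "\<exists>t. z + t *\<^sub>R (- y) \<in> K" for z
  proof -
    obtain s where s: "s > 0" "(1 / s) *\<^sub>R (- z) \<in> V"
      using neighbourhood_of_0_absorbs[OF V(1,3)] by blast
    then have "0 - s *\<^sub>R (y + (1 / s) *\<^sub>R (- z)) \<in> K" using 0 by (intro KI) auto
    moreover have "0 - s *\<^sub>R (y + (1 / s) *\<^sub>R (- z)) = z + s *\<^sub>R (- y)"
      using s(1) by (simp add: algebra_simps)
    ultimately show ?thesis by metis
  qed
  obtain \<xi> :: "'b \<Rightarrow> real" where lin: "linear \<xi>" and pos: "\<And>k. k \<in> K \<Longrightarrow> 0 \<le> \<xi> k"
    and one: "\<xi> (- y) = 1"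
    using positive_functional_of_order_unit[OF cone yK unit] by blast
  have neg: "\<xi> y = - 1" using one lin by (simp add: linear_neg)
  have up: "\<xi> v \<le> 1" if "v \<in> V" for v
  proof -
    have "0 \<le> \<xi> (0 - 1 *\<^sub>R (y + v))" using KI[OF 0, of 1 v] that pos by simp
    then show ?thesis using lin neg by (simp add: linear_diff linear_add linear_neg)
  qed
  have "continuous_on UNIV \<xi>"
  proof (rule linear_continuous_of_bounded_on_neighbourhood[OF lin])
    show "open (V \<inter> uminus -` V)"
      using V(1) by (intro open_Int open_vimage) (auto intro!: continuous_intros)
    show "0 \<in> V \<inter> uminus -` V" using V(3) by simp
    show "\<bar>\<xi> v\<bar> \<le> 1" if "v \<in> V \<inter> uminus -` V" for v
      using that up[of v] up[of "- v"] lin by (auto simp: linear_neg)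
  qed
  moreover have "0 \<le> \<xi> d" if "d \<in> D" for d
    using pos KI[OF that, of 0 0] V(3) by simp
  ultimately have "\<xi> \<in> dual_cone D" using lin by (simp add: dual_cone_def topological_dual_def)
  then show thesis using that neg by simp
qed

section \<open>Domination by multiples of the set \<open>H\<close>\<close>

definition dominates :: "'b::real_vector set \<Rightarrow> 'b set \<Rightarrow> real \<Rightarrow> 'b \<Rightarrow> bool" where
  "dominates D H t y \<longleftrightarrow> (\<exists>h\<in>H. y - t *\<^sub>R h \<in> D)"

lemma mem_translate_scaled_plus_iff_dominates:
  "y \<in> z +o ((*\<^sub>R) t ` H) + D \<longleftrightarrow> dominates D H t (y - z)"
proof
  assume "y \<in> z +o ((*\<^sub>R) t ` H) + D"
  then obtain h d where "h \<in> H" "d \<in> D" "y = z + t *\<^sub>R h + d"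
    by (auto simp: elt_set_plus_def set_plus_def)
  then show "dominates D H t (y - z)"
    unfolding dominates_def by (intro bexI[of _ h]) simp_all
next
  assume "dominates D H t (y - z)"
  then obtain h where h: "h \<in> H" "y - z - t *\<^sub>R h \<in> D" by (auto simp: dominates_def)
  have "y = (z + t *\<^sub>R h) + (y - z - t *\<^sub>R h)" by simp
  then show "y \<in> z +o ((*\<^sub>R) t ` H) + D"
    unfolding elt_set_plus_def set_plus_def using h by blast
qed

lemma dominates_zero:
  assumes "convex_cone D" "H \<noteq> {}"
  shows "dominates D H 0 0"
  using assms convex_cone_contains_0 by (fastforce simp: dominates_def)

lemma dominates_add_cone:
  assumes "convex_cone D" "dominates D H t y" "z - y \<in> D"
  shows "dominates D H t z"
proof -
  obtain h where "h \<in> H" "y - t *\<^sub>R h \<in> D" using assms(2) by (auto simp: dominates_def)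
  then have "(z - y) + (y - t *\<^sub>R h) \<in> D" using assms convex_cone_add by blast
  then show ?thesis using \<open>h \<in> H\<close> by (auto simp: dominates_def)
qed

lemma dominates_antimono:
  assumes "convex_cone D" "H \<subseteq> D" "dominates D H t y" "s \<le> t"
  shows "dominates D H s y"
proof -
  obtain h where h: "h \<in> H" "y - t *\<^sub>R h \<in> D" using assms(3) by (auto simp: dominates_def)
  then have "(y - t *\<^sub>R h) + (t - s) *\<^sub>R h \<in> D"
    using assms by (intro convex_cone_add convex_cone_scaleR) auto
  then show ?thesis using h by (auto simp: dominates_def algebra_simps)
qed

text \<open>
  This is where convexity of \<open>H + D\<close> enters: the convex combination of \<open>h1\<close> and \<open>h2\<close> with weights
  proportional to \<open>s\<close> and \<open>t\<close> need not lie in \<open>H\<close>, but it lies in \<open>H + D\<close>.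
\<close>

lemma dominates_add:
  assumes D: "convex_cone D" and H: "cone_convex D H" and s: "s \<ge> 0" and t: "t \<ge> 0"
    and y: "dominates D H s y" and z: "dominates D H t z"
  shows "dominates D H (s + t) (y + z)"
proof -
  obtain h1 h2 where h1: "h1 \<in> H" "y - s *\<^sub>R h1 \<in> D" and h2: "h2 \<in> H" "z - t *\<^sub>R h2 \<in> D"
    using y z by (auto simp: dominates_def)
  note add = convex_cone_add[OF D]
  have sum: "(y - s *\<^sub>R h1) + (z - t *\<^sub>R h2) \<in> D" using h1 h2 add by blast
  show ?thesis
  proof (cases "s + t = 0")
    case True
    then have "s = 0" "t = 0" using s t by auto
    then show ?thesis using sum h1(1) by (auto simp: dominates_def)
  next
    case False
    then have st: "s + t > 0" using s t by auto
    have "0 \<in> D" using D convex_cone_contains_0 by blast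
    then have "H \<subseteq> H + D" by (force simp: set_plus_def)
    then have "(s / (s + t)) *\<^sub>R h1 + (t / (s + t)) *\<^sub>R h2 \<in> H + D"
      using H s t st h1 h2 unfolding cone_convex_def
      by (intro convexD) (auto simp: add_divide_distrib[symmetric])
    then obtain h d where hd: "h \<in> H" "d \<in> D"
      and eq: "(s / (s + t)) *\<^sub>R h1 + (t / (s + t)) *\<^sub>R h2 = h + d"
      by (auto simp: set_plus_def)
    have "s *\<^sub>R h1 + t *\<^sub>R h2 = (s + t) *\<^sub>R ((s / (s + t)) *\<^sub>R h1 + (t / (s + t)) *\<^sub>R h2)"
      using st by (simp add: scaleR_right_distrib)
    also have "\<dots> = (s + t) *\<^sub>R h + (s + t) *\<^sub>R d" by (simp add: eq scaleR_right_distrib)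
    finally have "y + z - (s + t) *\<^sub>R h = ((y - s *\<^sub>R h1) + (z - t *\<^sub>R h2)) + (s + t) *\<^sub>R d"
      by (simp add: algebra_simps)
    also have "\<dots> \<in> D" using hd(2) st by (intro add[OF sum] convex_cone_scaleR[OF D]) simp_all
    finally show ?thesis using hd by (auto simp: dominates_def)
  qed
qed

text \<open>
  The witnesses \<open>h n\<close> for the parameters \<open>t n\<close> have a cluster point \<open>h'\<close>; a functional in the dual
  cone that is negative at \<open>y - l h'\<close> would be negative at some \<open>y - t n h n\<close> too, because it takes
  values close to \<open>\<xi> h'\<close> at infinitely many of the witnesses.
\<close>

lemma dominates_limit:
  fixes D H :: "'b::locally_convex_space set"
  assumes D: "closed D" "convex_cone D" and H: "countably_compact_in (sigma_topology D) H"
    and t: "t \<longlonglongrightarrow> l" and t0: "\<And>n. 0 \<le> t n" and dom: "\<And>n. dominates D H (t n) y"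
  shows "dominates D H l y"
proof -
  have l: "0 \<le> l" using t t0 by (intro LIMSEQ_le_const) auto
  obtain h where h: "\<And>n. h n \<in> H" "\<And>n. y - t n *\<^sub>R h n \<in> D"
    using dom unfolding dominates_def by metis
  then have "range h \<subseteq> H" by blast
  then obtain h' where h': "h' \<in> H" and cl: "cluster_point_in (sigma_topology D) h h'"
    using H unfolding countably_compact_in_def by blast
  have "y - l *\<^sub>R h' \<in> D"
  proof (rule ccontr)
    assume "y - l *\<^sub>R h' \<notin> D"
    then obtain \<xi> where \<xi>: "\<xi> \<in> dual_cone D" and neg: "\<xi> (y - l *\<^sub>R h') < 0"
      using separate_point_from_closed_convex_cone[OF D] by blast
    have lin: "linear \<xi>" using \<xi> by (simp add: dual_cone_def topological_dual_def)
    have neg': "\<xi> y < l * \<xi> h'" using neg lin by (simp add: linear_diff linear_cmul)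
    \<comment> \<open>Small enough that \<open>\<xi> y < l * (\<xi> h' - \<delta>)\<close>; the \<open>l + 1\<close> also covers \<open>l = 0\<close>.\<close>
    define \<delta> where "\<delta> = (l * \<xi> h' - \<xi> y) / (l + 1)"
    have \<delta>: "\<delta> > 0" using neg' l by (simp add: \<delta>_def)
    have "(l + 1) * \<delta> = l * \<xi> h' - \<xi> y" using l by (simp add: \<delta>_def)
    then have "\<xi> y < l * (\<xi> h' - \<delta>)" using \<delta> by (simp add: algebra_simps)
    moreover have "(\<lambda>n. t n * (\<xi> h' - \<delta>)) \<longlonglongrightarrow> l * (\<xi> h' - \<delta>)"
      by (intro tendsto_intros t)
    ultimately have ev: "\<forall>\<^sub>F n in sequentially. \<xi> y < t n * (\<xi> h' - \<delta>)"
      by (metis order_tendstoD(1))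
    let ?U = "{z. \<bar>\<xi> (z - h')\<bar> < \<delta>}"
    have "openin (sigma_topology D) ?U"
      unfolding sigma_topology_def seminorm_topology_def
    proof (rule topology_generated_by_Basis)
      show "?U \<in> {{z. p (z - a) < r} | p a r. p \<in> (\<lambda>\<xi> z. \<bar>\<xi> z\<bar>) ` dual_cone D \<and> 0 < r}"
        using \<delta> by (intro CollectI exI[of _ "\<lambda>z. \<bar>\<xi> z\<bar>"] exI[of _ h'] exI[of _ \<delta>])
          (simp add: imageI \<xi>)
    qed
    moreover have "h' \<in> ?U" using \<delta> linear_0[OF lin] by simp
    ultimately have "\<exists>\<^sub>F n in sequentially. h n \<in> ?U"
      using cl unfolding cluster_point_in_def by blast
    then obtain n where n: "h n \<in> ?U" "\<xi> y < t n * (\<xi> h' - \<delta>)"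
      using frequently_eventually_conj[OF _ ev] frequently_ex by (smt (verit, best))
    then have "\<xi> h' - \<delta> \<le> \<xi> (h n)" using lin by (simp add: linear_diff)
    then have "\<xi> y < t n * \<xi> (h n)" using n(2) mult_left_mono[OF _ t0] by (meson less_le_trans)
    moreover have "0 \<le> \<xi> (y - t n *\<^sub>R h n)" using \<xi> h(2) by (simp add: dual_cone_def)
    ultimately show False using lin by (simp add: linear_diff linear_cmul)
  qed
  then show ?thesis using h' by (auto simp: dominates_def)
qed

section \<open>Greedy descent in a complete metric space\<close>

lemma Cauchy_of_bounded_length:
  fixes s :: "nat \<Rightarrow> 'a::metric_space"
  assumes "\<And>n. (\<Sum>i<n. dist (s i) (s (Suc i))) \<le> B"
  shows "Cauchy s" "(\<lambda>n. dist (s n) (s (Suc n))) \<longlonglongrightarrow> 0"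
proof -
  let ?d = "\<lambda>n. dist (s n) (s (Suc n))"
  have sm: "summable ?d" using assms by (intro summableI_nonneg_bounded[of _ B]) auto
  then show "?d \<longlonglongrightarrow> 0" by (rule summable_LIMSEQ_zero)
  have tri: "dist (s m) (s n) \<le> sum ?d {m..<n}" if "m \<le> n" for m n
    using that
  proof (induction n rule: dec_induct)
    case (step n)
    have "dist (s m) (s (Suc n)) \<le> dist (s m) (s n) + ?d n" by (rule dist_triangle)
    then show ?case using step by simp
  qed simp
  show "Cauchy s"
    unfolding Cauchy_altdef
  proof (intro allI impI)
    fix e :: real assume "e > 0"
    then obtain N where N: "\<And>m n. m \<ge> N \<Longrightarrow> norm (sum ?d {m..<n}) < e"
      using sm unfolding summable_Cauchy by blast
    have "dist (s m) (s n) < e" if "m \<ge> N" "n > m" for m n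
      using tri[of m n] N[of m n] that by simp
    then show "\<exists>M. \<forall>m\<ge>M. \<forall>n>m. dist (s m) (s n) < e" by blast
  qed
qed

text \<open>
  The greedy choice makes every point reachable from the whole chain at most twice as far from \<open>s n\<close>
  as \<open>s (Suc n)\<close> is. Jumps tend to \<open>0\<close>, so such a point is the limit of the chain.
\<close>

lemma exists_terminal_point:
  fixes S :: "'a::complete_space set" and R :: "'a \<Rightarrow> 'a \<Rightarrow> bool"
  assumes S: "closed S" "x0 \<in> S"
    and refl: "\<And>x. R x x" and trans: "\<And>x y z. R x y \<Longrightarrow> R y z \<Longrightarrow> R x z"
    and limit: "\<And>s x n. s \<longlonglongrightarrow> x \<Longrightarrow> (\<And>n m. n < m \<Longrightarrow> R (s n) (s m)) \<Longrightarrow> R (s n) x"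
    and length: "\<And>s n. s 0 = x0 \<Longrightarrow> (\<And>n. s n \<in> S) \<Longrightarrow> (\<And>n. R (s n) (s (Suc n)))
      \<Longrightarrow> (\<Sum>i<n. dist (s i) (s (Suc i))) \<le> B"
  obtains x where "x \<in> S" "R x0 x" "\<And>z. z \<in> S \<Longrightarrow> R x z \<Longrightarrow> z = x"
proof -
  have bounded: "dist x0 z \<le> B" if z: "z \<in> S" "R x0 z" for z
    using length[of "\<lambda>n. if n = 0 then x0 else z" 1] z S(2) refl by simp
  have greedy: "\<exists>y. (y \<in> S \<and> R x0 y) \<and> R x y \<and> (\<forall>z\<in>S. R x z \<longrightarrow> dist x z \<le> 2 * dist x y)"
    if x: "x \<in> S" "R x0 x" for x
  proof -
    let ?A = "dist x ` {z\<in>S. R x z}"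
    have ne: "?A \<noteq> {}" using x refl by blast
    have "dist x z \<le> 2 * B" if z: "z \<in> S" "R x z" for z
      using bounded[OF z(1) trans[OF x(2) z(2)]] bounded[OF x] dist_triangle3[of x z x0] by simp
    then have bdd: "bdd_above ?A" by (intro bdd_aboveI[of _ "2 * B"]) auto
    have upper: "dist x z \<le> Sup ?A" if "z \<in> S" "R x z" for z
      using that by (intro cSup_upper bdd) auto
    obtain y where y: "y \<in> S" "R x y" "Sup ?A \<le> 2 * dist x y"
    proof (cases "Sup ?A > 0")
      case True
      then obtain y where "y \<in> S" "R x y" "Sup ?A / 2 < dist x y"
        using less_cSup_iff[OF ne bdd, of "Sup ?A / 2"] by auto
      then show ?thesis using that by simp
    next
      case False
      then show ?thesis using that[of x] x refl by simp
    qed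
    show ?thesis
    proof (intro exI conjI ballI impI)
      show "y \<in> S" "R x0 y" "R x y" using y x trans by blast+
      show "dist x z \<le> 2 * dist x y" if "z \<in> S" "R x z" for z
        using upper[OF that] y(3) by linarith
    qed
  qed
  have "\<exists>s. \<forall>n. ((s n \<in> S \<and> R x0 (s n)) \<and> (n = 0 \<longrightarrow> s n = x0)) \<and>
      (R (s n) (s (Suc n)) \<and> (\<forall>z\<in>S. R (s n) z \<longrightarrow> dist (s n) z \<le> 2 * dist (s n) (s (Suc n))))"
  proof (rule dependent_nat_choice)
    show "\<exists>x. (x \<in> S \<and> R x0 x) \<and> ((0::nat) = 0 \<longrightarrow> x = x0)"
      using S(2) refl[of x0] by auto
  next
    fix x and n :: nat assume "(x \<in> S \<and> R x0 x) \<and> (n = 0 \<longrightarrow> x = x0)"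
    then obtain y where "(y \<in> S \<and> R x0 y) \<and> R x y \<and> (\<forall>z\<in>S. R x z \<longrightarrow> dist x z \<le> 2 * dist x y)"
      using greedy by blast
    then show "\<exists>y. ((y \<in> S \<and> R x0 y) \<and> (Suc n = 0 \<longrightarrow> y = x0)) \<and>
        (R x y \<and> (\<forall>z\<in>S. R x z \<longrightarrow> dist x z \<le> 2 * dist x y))" by auto
  qed
  then obtain s where sS: "\<And>n. s n \<in> S" and s0: "s 0 = x0" and step: "\<And>n. R (s n) (s (Suc n))"
    and far: "\<And>n z. z \<in> S \<Longrightarrow> R (s n) z \<Longrightarrow> dist (s n) z \<le> 2 * dist (s n) (s (Suc n))"
    by metis
  have len: "(\<Sum>i<n. dist (s i) (s (Suc i))) \<le> B" for n
    using length[of s n] s0 sS step by blast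
  have "Cauchy s" using len by (rule Cauchy_of_bounded_length)
  then obtain x where x: "s \<longlonglongrightarrow> x" using Cauchy_convergent by (auto simp: convergent_def)
  have chain: "R (s n) (s m)" if "n < m" for n m
    using that by (induction rule: less_Suc_induct) (use step trans in blast)+
  have Rx: "R (s n) x" for n using limit[OF x] chain by blast
  show thesis
  proof
    show "x \<in> S" using closed_sequentially[OF S(1)] sS x by blast
    show "R x0 x" using Rx[of 0] s0 by simp
    fix z assume z: "z \<in> S" "R x z"
    have jumps: "(\<lambda>n. 2 * dist (s n) (s (Suc n))) \<longlonglongrightarrow> 0"
      using tendsto_mult_left[OF Cauchy_of_bounded_length(2)[OF len], of 2] by simp
    have "(\<lambda>n. dist (s n) z) \<longlonglongrightarrow> 0"
      using far[OF z(1) trans[OF Rx z(2)]]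
      by (intro tendsto_sandwich[OF _ _ tendsto_const jumps]) auto
    then have "s \<longlonglongrightarrow> z" by (simp add: tendsto_dist_iff[of s])
    then show "z = x" using x LIMSEQ_unique by blast
  qed
qed

section \<open>Ekeland's principle for efficiency in the sense of Nemeth\<close>

theorem theorem4p3:
  fixes S :: "'a::complete_space set"
    and D H :: "'b::locally_convex_space set"
    and f :: "'a \<Rightarrow> 'b"
    and \<epsilon> :: real and x0 :: 'a
  assumes "S \<noteq> {}" and "closed S"
    and "closed D" and "convex_cone D"
    and "H \<noteq> {}" and "H \<subseteq> D - uminus ` D"
    and "countably_compact_in (sigma_topology D) H"
    and "cone_convex D H"
    and "submonotone D f"
    and "\<epsilon> > 0"
    and "nemeth_efficient f S D H \<epsilon> x0"
  shows "\<forall>\<gamma>>0. \<exists>xh\<in>S.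
           f x0 \<in> f xh +o ((*\<^sub>R) (\<gamma> * dist x0 xh) ` H) + D
         \<and> dist x0 xh < \<epsilon> / \<gamma>
         \<and> (\<forall>x\<in>S - {xh}. f xh \<notin> f x +o ((*\<^sub>R) (\<gamma> * dist xh x) ` H) + D)"
proof (intro allI impI)
  fix \<gamma> :: real assume \<gamma>: "\<gamma> > 0"
  note D = assms(4)
  have HD: "H \<subseteq> D" using assms(6) by blast
  have x0: "x0 \<in> S" using assms(11) by (simp add: nemeth_efficient_def)
  have le_cone_iff: "le_cone D y z \<longleftrightarrow> z - y \<in> D" for y z
    unfolding le_cone_def by (metis image_eqI minus_diff_eq imageE minus_minus)
  have efficient: "\<not> dominates D H \<epsilon> (f x0 - f x)" if "x \<in> S" for x
  proof
    assume "dominates D H \<epsilon> (f x0 - f x)"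
    then obtain h where h: "h \<in> H" "f x0 - f x - \<epsilon> *\<^sub>R h \<in> D" by (auto simp: dominates_def)
    have "f x - f x0 = (- \<epsilon>) *\<^sub>R h + - (f x0 - f x - \<epsilon> *\<^sub>R h)" by simp
    then have "f x - f x0 \<in> (*\<^sub>R) (- \<epsilon>) ` H + uminus ` D"
      unfolding set_plus_def using h by blast
    then show False using assms(11) that unfolding nemeth_efficient_def by blast
  qed
  have small: "t < \<epsilon> / \<gamma>" if "x \<in> S" "dominates D H (\<gamma> * t) (f x0 - f x)" for x t
  proof (rule ccontr)
    assume "\<not> t < \<epsilon> / \<gamma>"
    then have "\<epsilon> \<le> \<gamma> * t" using \<gamma> by (simp add: field_simps)
    then show False using efficient[OF that(1)] dominates_antimono[OF D HD that(2)] by blast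
  qed
  define R where "R x z \<longleftrightarrow> dominates D H (\<gamma> * dist x z) (f x - f z)" for x z
  have refl: "R x x" for x using dominates_zero[OF D assms(5)] by (simp add: R_def)
  have chain_sum: "dominates D H (\<gamma> * (s + t)) (f x - f z)"
    if "dominates D H (\<gamma> * s) (f x - f y)" "dominates D H (\<gamma> * t) (f y - f z)" "s \<ge> 0" "t \<ge> 0"
    for s t x y z
    using dominates_add[OF D assms(8) _ _ that(1,2)] that(3,4) \<gamma>
    by (simp add: distrib_left)
  have trans: "R x z" if "R x y" "R y z" for x y z
  proof -
    have "dominates D H (\<gamma> * (dist x y + dist y z)) (f x - f z)"
      using chain_sum that unfolding R_def by simp
    then show ?thesis
      unfolding R_def by (rule dominates_antimono[OF D HD]) (simp add: dist_triangle \<gamma>)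
  qed
  have limit: "R (s n) x" if s: "s \<longlonglongrightarrow> x" and desc: "\<And>n m. n < m \<Longrightarrow> R (s n) (s m)" for s x n
  proof -
    have "le_cone D (f (s m)) (f (s k))" if "k < m" for k m
    proof -
      have "dominates D H 0 (f (s k) - f (s m))"
        using desc[OF that] \<gamma> unfolding R_def by (auto intro: dominates_antimono[OF D HD])
      then show ?thesis using le_cone_iff by (auto simp: dominates_def)
    qed
    then have below: "f (s m) - f x \<in> D" for m
      using assms(9) s le_cone_iff unfolding submonotone_def by blast
    have dom: "dominates D H (\<gamma> * dist (s n) (s (n + Suc m))) (f (s n) - f x)" for m
      using desc[of n "n + Suc m"] below[of "n + Suc m"] unfolding R_def
      by (auto intro: dominates_add_cone[OF D])
    have "(\<lambda>m. s (n + Suc m)) \<longlonglongrightarrow> x"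
      using LIMSEQ_ignore_initial_segment[OF s, of "Suc n"] by (simp add: add.commute)
    then have "(\<lambda>m. \<gamma> * dist (s n) (s (n + Suc m))) \<longlonglongrightarrow> \<gamma> * dist (s n) x"
      by (intro tendsto_intros)
    then show ?thesis
      unfolding R_def by (rule dominates_limit[OF assms(3) D assms(7) _ _ dom]) (use \<gamma> in simp)
  qed
  have length: "(\<Sum>i<n. dist (s i) (s (Suc i))) \<le> \<epsilon> / \<gamma>"
    if s: "s 0 = x0" "\<And>n. s n \<in> S" "\<And>n. R (s n) (s (Suc n))" for s n
  proof -
    have "dominates D H (\<gamma> * (\<Sum>i<n. dist (s i) (s (Suc i)))) (f x0 - f (s n))"
    proof (induction n)
      case 0
      then show ?case using dominates_zero[OF D assms(5)] s(1) by simp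
    next
      case (Suc n)
      then show ?case using chain_sum[OF Suc] s(3)[of n] by (simp add: R_def sum_nonneg)
    qed
    then show ?thesis using small s(2) by (meson less_imp_le)
  qed
  obtain x where x: "x \<in> S" "R x0 x" and last: "\<And>z. z \<in> S \<Longrightarrow> R x z \<Longrightarrow> z = x"
  proof (rule exists_terminal_point[of S x0 R "\<epsilon> / \<gamma>"])
    show "R (s n) y" if "s \<longlonglongrightarrow> y" "\<And>n m. n < m \<Longrightarrow> R (s n) (s m)" for s y n
      using that by (rule limit)
    show "(\<Sum>i<n. dist (s i) (s (Suc i))) \<le> \<epsilon> / \<gamma>"
      if "s 0 = x0" "\<And>n. s n \<in> S" "\<And>n. R (s n) (s (Suc n))" for s n
      using that by (rule length)
    show "R y w" if "R y z" "R z w" for y z w using that by (rule trans)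
  qed (use assms(2) x0 refl that in simp_all)
  show "\<exists>xh\<in>S. f x0 \<in> f xh +o ((*\<^sub>R) (\<gamma> * dist x0 xh) ` H) + D
      \<and> dist x0 xh < \<epsilon> / \<gamma>
      \<and> (\<forall>x\<in>S - {xh}. f xh \<notin> f x +o ((*\<^sub>R) (\<gamma> * dist xh x) ` H) + D)"
    unfolding mem_translate_scaled_plus_iff_dominates R_def[symmetric]
  proof (intro bexI[of _ x] conjI ballI)
    show "dist x0 x < \<epsilon> / \<gamma>" using small[OF x(1)] x(2) by (simp add: R_def)
    show "\<not> R x z" if "z \<in> S - {x}" for z using last that by blast
  qed (rule x)+
qed

end
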